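(* Let $s\ge1$ be an integer, let $p,q\in(0,1)$ satisfy $\sum_{k=0}^{s}p^kq^{s-k}=1$, and let $X\sim\mathcal{B}^{(s)}(p)$ follow the $s$-Bernoulli distribution. Let $r\ge1$ be an integer. Then the $r$-th moment $m_r(s)=E(X^r)$ is given by $$m_r(s)=\frac{(-1)^r}{(p-q)^{r+1}}\,p\sum_{k=0}^{r}\Big(A(r,k,s+1)\,p^{r-k+s}q^{k}-A(r,k,1)\,p^{r-k}q^{k+s}\Big)\quad\text{if }p\neq q,$$ and $$m_r(s)=\frac{1}{(r+1)(s+1)}\sum_{k=0}^{r}(-1)^k\binom{r+1}{k}B_k\,s^{r-k+1}\quad\text{if }p=q.$$
   Context: The $s$-Bernoulli distribution $\mathcal{B}^{(s)}(p)$, where $p,q\in(0,1)$ satisfy $\sum_{k=0}^s p^kq^{s-k}=1$, is the law on $\{0,1,\dots,s\}$ with $\mathbb{P}(X=k)=p^kq^{s-k}$. For integers $n,s\ge0$ and $0\le k\le n$, the extended Eulerian number is $$A(n,k,s)=\sum_{j=0}^{k}(-1)^j\binom{n+1}{j}(k+1-j-s)^n.$$ The $B_k$ are the Bernoulli numbers with the convention $B_1=-\tfrac12$ (i.e. $\frac{t}{e^t-1}=\sum_{k\ge0}B_k\frac{t^k}{k!}$). *)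

theory Defs
  imports
    "HOL-Probability.Probability"
    "HOL-Computational_Algebra.Formal_Power_Series"
begin

(* The parameter q is determined by s and p through the normalisation
   (\<Sum>k\<le>s. p ^ k * q ^ (s - k)) = 1; it is kept as an explicit argument.
   embed_pmf is meaningful only under this normalisation, see pmf_s_bernoulli. *)
definition s_bernoulli_pmf :: "nat \<Rightarrow> real \<Rightarrow> real \<Rightarrow> nat pmf" where
  "s_bernoulli_pmf s p q = embed_pmf (\<lambda>k. if k \<le> s then p ^ k * q ^ (s - k) else 0)"

lemma pmf_s_bernoulli:
  assumes "0 < p" "0 < q" "(\<Sum>k=0..s. p ^ k * q ^ (s - k)) = 1"
  shows "pmf (s_bernoulli_pmf s p q) k = (if k \<le> s then p ^ k * q ^ (s - k) else 0)"
  unfolding s_bernoulli_pmf_def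
proof (rule pmf_embed_pmf)
  let ?f = "\<lambda>k. if k \<le> s then p ^ k * q ^ (s - k) else 0"
  show nonneg: "0 \<le> ?f k" for k
    using assms by simp
  have "(\<integral>\<^sup>+ k. ennreal (?f k) \<partial>count_space UNIV) =
      (\<integral>\<^sup>+ k. ennreal (p ^ k * q ^ (s - k)) * indicator {0..s} k \<partial>count_space UNIV)"
    by (intro nn_integral_cong) (auto split: split_indicator)
  also have "\<dots> = (\<integral>\<^sup>+ k. ennreal (p ^ k * q ^ (s - k)) \<partial>count_space {0..s})"
    by (simp add: nn_integral_count_space_indicator)
  also have "\<dots> = (\<Sum>k=0..s. ennreal (p ^ k * q ^ (s - k)))"
    by (simp add: nn_integral_count_space_finite)
  also have "\<dots> = ennreal (\<Sum>k=0..s. p ^ k * q ^ (s - k))"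
    using assms by (intro sum_ennreal) simp
  finally show "(\<integral>\<^sup>+ k. ennreal (?f k) \<partial>count_space UNIV) = 1"
    using assms by simp
qed

definition ext_eulerian :: "nat \<Rightarrow> nat \<Rightarrow> nat \<Rightarrow> int" where
  "ext_eulerian n k s =
     (\<Sum>j=0..k. (- 1) ^ j * int ((n + 1) choose j) * (int k + 1 - int j - int s) ^ n)"

(* B_k is k! times the k-th coefficient of t / (e^t - 1). Numerator and denominator
   both have subdegree 1, so the quotient is a genuine power series. *)
definition bernoulli_number :: "nat \<Rightarrow> real" where
  "bernoulli_number k = fact k * fps_nth (fps_X / (fps_exp 1 - 1)) k"

lemma bernoulli_number_egf:
  "Abs_fps (\<lambda>k. bernoulli_number k / fact k) * (fps_exp 1 - 1) = fps_X"
proof -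
  have nz: "fps_nth (fps_exp 1 - 1 :: real fps) 1 \<noteq> 0"
    by simp
  hence ne: "(fps_exp 1 - 1 :: real fps) \<noteq> 0"
    by (metis fps_zero_nth)
  have "subdegree (fps_exp 1 - 1 :: real fps) = 1"
    using nz by (intro subdegreeI) auto
  hence "(fps_exp 1 - 1 :: real fps) dvd fps_X"
    using ne by (simp add: fps_dvd_iff)
  moreover have "Abs_fps (\<lambda>k. bernoulli_number k / fact k) = fps_X / (fps_exp 1 - 1)"
    by (simp add: fps_eq_iff bernoulli_number_def)
  ultimately show ?thesis
    by simp
qed

end

(*
  Case p \<noteq> q: the alternating sums defining A(r, k, s + 1) are the coefficients of
  (1 - x)^(r + 1) * (\<Sum>i. (i - s)^r x^i), which is a polynomial of degree at most r because
  (r + 1)-st differences kill polynomials of degree r. Subtracting x^s times the series for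
  s = 0 leaves the finite sum over i < s, and the moment is read off at x = q / p after
  reversing the summation, k = s - i.
  Case p = q: X is uniform on {0..s}, and the formula is Faulhaber's.
*)

theory Submission
  imports Defs "HOL-Computational_Algebra.Polynomial_FPS"
begin

section \<open>Finite differences and vanishing of extended Eulerian numbers\<close>

text \<open>Induction on the exponent: one factor \<open>x - j\<close> is split off. Its
  \<open>x\<close> part is the induction hypothesis for the same \<open>n\<close>; in its
  \<open>j\<close> part the factor \<open>j\<close> is absorbed into the binomial, which leaves the
  sum for \<open>n - 1\<close> at \<open>x - 1\<close>.\<close>

lemma alternating_binomial_sum_power_eq_0:
  fixes x :: "'a::comm_ring_1"
  assumes "r < n"
  shows "(\<Sum>j\<le>n. (- 1) ^ j * of_nat (n choose j) * (x - of_nat j) ^ r) = 0"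
  using assms
proof (induction r arbitrary: n x)
  case 0
  then show ?case
    using choose_alternating_sum[of n, where 'a = 'a] by simp
next
  case (Suc r)
  then obtain m where m: "n = Suc m" "r < m"
    by (cases n) auto
  let ?S = "\<lambda>n x r. \<Sum>j\<le>n. (- 1) ^ j * of_nat (n choose j) * (x - of_nat j) ^ r :: 'a"
  have "(\<Sum>j\<le>n. (- 1) ^ j * of_nat (j * (n choose j)) * (x - of_nat j) ^ r)
      = (\<Sum>j\<le>m. (- 1) ^ Suc j * of_nat (Suc m * (m choose j)) * (x - of_nat (Suc j)) ^ r)"
    unfolding m(1) sum.atMost_Suc_shift by (simp only: binomial_absorption) simp
  also have "\<dots> = - of_nat (Suc m) * ?S m (x - 1) r"
    unfolding sum_distrib_left by (intro sum.cong) (auto simp: algebra_simps)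
  also have "\<dots> = 0"
    using Suc.IH m(2) by simp
  finally have absorbed:
    "(\<Sum>j\<le>n. (- 1) ^ j * of_nat (j * (n choose j)) * (x - of_nat j) ^ r) = 0" .
  have "?S n x (Suc r) = x * ?S n x r
      - (\<Sum>j\<le>n. (- 1) ^ j * of_nat (j * (n choose j)) * (x - of_nat j) ^ r)"
    unfolding sum_distrib_left sum_subtractf[symmetric]
    by (intro sum.cong) (auto simp: algebra_simps)
  then show ?case
    using absorbed Suc.IH[of n x] Suc.prems by simp
qed

lemma ext_eulerian_eq_0:
  assumes "n < k"
  shows "ext_eulerian n k s = 0"
proof -
  have "ext_eulerian n k s =
      (\<Sum>j\<le>n + 1. (- 1) ^ j * of_nat ((n + 1) choose j) * (int k + 1 - int s - of_nat j) ^ n)"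
    unfolding ext_eulerian_def using assms
    \<comment> \<open>Since \<open>n + 1 \<le> k\<close>, the truncated sum contains every nonzero
      binomial, so it is a full (n+1)-st difference of a polynomial of degree
      \<open>n\<close>.\<close>
    by (intro sum.mono_neutral_cong_right) (auto simp: algebra_simps)
  then show ?thesis
    by (simp only: alternating_binomial_sum_power_eq_0 less_add_one)
qed

section \<open>Generating functions of the extended Eulerian numbers\<close>

text \<open>For \<open>s = 1\<close> this is the numerator of the classical series of i^n x^i over
  (1 - x)^(n+1). Stopping at degree \<open>n\<close> loses nothing, by
  \<open>ext_eulerian_eq_0\<close>.\<close>

definition ext_eulerian_poly :: "nat \<Rightarrow> nat \<Rightarrow> real poly" where
  "ext_eulerian_poly n s = (\<Sum>k=0..n. monom (of_int (ext_eulerian n k s)) k)"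

lemma coeff_ext_eulerian_poly: "coeff (ext_eulerian_poly n s) k = of_int (ext_eulerian n k s)"
  by (auto simp: ext_eulerian_poly_def coeff_sum ext_eulerian_eq_0)

lemma poly_ext_eulerian_poly:
  "poly (ext_eulerian_poly n s) x = (\<Sum>k=0..n. of_int (ext_eulerian n k s) * x ^ k)"
  by (simp add: ext_eulerian_poly_def poly_sum poly_monom)

lemma coeff_one_minus_X_power:
  "coeff ([:1, - 1:] ^ n) j = (- 1) ^ j * (of_nat (n choose j) :: 'a::idom)"
proof (cases "j \<le> n")
  case True
  then show ?thesis
    by (simp add: coeff_linear_poly_power mult.commute)
next
  case False
  then have "degree ([:1, - 1 :: 'a:] ^ n) < j"
    by (simp add: degree_power_eq)
  with False show ?thesis
    by (simp add: coeff_eq_0 binomial_eq_0)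
qed

text \<open>The Cauchy product is the defining alternating sum term by term. The parameter is
  \<open>s + 1\<close> because the definition of \<open>ext_eulerian\<close> contains
  \<open>k + 1\<close>.\<close>

lemma shifted_power_series_eq_ext_eulerian:
  "fps_of_poly ([:1, - 1:] ^ (n + 1)) * Abs_fps (\<lambda>i. (real i - real s) ^ n)
     = fps_of_poly (ext_eulerian_poly n (s + 1))"
proof (rule fps_ext)
  fix k
  show "fps_nth (fps_of_poly ([:1, - 1:] ^ (n + 1)) * Abs_fps (\<lambda>i. (real i - real s) ^ n)) k
      = fps_nth (fps_of_poly (ext_eulerian_poly n (s + 1))) k"
    unfolding fps_mult_nth fps_of_poly_nth coeff_one_minus_X_power coeff_ext_eulerian_poly
      ext_eulerian_def of_int_sum
    by (intro sum.cong) (auto simp: of_nat_diff algebra_simps)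
qed

lemma finite_power_sum_eq_ext_eulerian:
  "[:1, - 1:] ^ (n + 1) * (\<Sum>i<s. monom ((real i - real s) ^ n) i)
     = ext_eulerian_poly n (s + 1) - monom 1 s * ext_eulerian_poly n 1"
proof -
  define F where "F s = Abs_fps (\<lambda>i. (real i - real s) ^ n)" for s
  define T where "T = (\<Sum>i<s. monom ((real i - real s) ^ n) i)"
  \<comment> \<open>From index \<open>s\<close> on, the coefficients of \<open>F s\<close> are those
    of \<open>F 0\<close> moved up by \<open>s\<close> places; \<open>T\<close> collects the ones
    before.\<close>
  have "F s = fps_of_poly T + fps_X ^ s * F 0"
    by (rule fps_ext)
      (auto simp: F_def T_def coeff_sum fps_X_power_mult_nth of_nat_diff)
  then have "fps_of_poly T = F s - fps_X ^ s * F 0"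
    by simp
  then have "fps_of_poly ([:1, - 1:] ^ (n + 1) * T)
      = fps_of_poly ([:1, - 1:] ^ (n + 1)) * F s
        - fps_X ^ s * (fps_of_poly ([:1, - 1:] ^ (n + 1)) * F 0)"
    by (simp only: fps_of_poly_mult right_diff_distrib mult.left_commute)
  also have "\<dots> = fps_of_poly (ext_eulerian_poly n (s + 1) - monom 1 s * ext_eulerian_poly n 1)"
    using shifted_power_series_eq_ext_eulerian[of n 0]
    unfolding F_def shifted_power_series_eq_ext_eulerian
    by (simp add: fps_of_poly_diff fps_of_poly_mult fps_of_poly_monom')
  finally show ?thesis
    by (simp only: fps_of_poly_eq_iff T_def)
qed

text \<open>Both sides are homogeneous: with \<open>y = q / p\<close>, powers of \<open>p\<close>
  factor out and what remains is \<open>finite_power_sum_eq_ext_eulerian\<close> evaluated at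
  \<open>y\<close>.\<close>

lemma homogeneous_power_sum:
  fixes p q :: real
  assumes "p \<noteq> 0" "p \<noteq> q" "n \<ge> 1"
  shows "(\<Sum>k=0..s. real k ^ n * (p ^ k * q ^ (s - k))) =
      (- 1) ^ n / (p - q) ^ (n + 1) * p *
      (\<Sum>k=0..n. of_int (ext_eulerian n k (s + 1)) * p ^ (n - k + s) * q ^ k
                - of_int (ext_eulerian n k 1) * p ^ (n - k) * q ^ (k + s))"
proof -
  define y where "y = q / p"
  have q: "q = p * y" using assms by (simp add: y_def)
  have y: "1 - y \<noteq> 0" using assms by (simp add: y_def)
  define T where "T = (\<Sum>i<s. (real i - real s) ^ n * y ^ i)"
  define P where "P s = (\<Sum>k=0..n. of_int (ext_eulerian n k s) * y ^ k)" for s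
  have "(\<Sum>k=0..s. real k ^ n * (p ^ k * q ^ (s - k)))
      = (\<Sum>i=0..s. real (s - i) ^ n * (p ^ (s - i) * q ^ i))"
    by (subst sum.atLeastAtMost_rev) (auto intro!: sum.cong)
  \<comment> \<open>The term \<open>i = s\<close> is \<open>0 ^ n\<close>, which vanishes because
    \<open>n \<ge> 1\<close>.\<close>
  also have "\<dots> = (\<Sum>i<s. real (s - i) ^ n * (p ^ (s - i) * q ^ i))"
    using assms by (intro sum.mono_neutral_right) auto
  also have "\<dots> = (\<Sum>i<s. (- 1) ^ n * p ^ s * ((real i - real s) ^ n * y ^ i))"
  proof (intro sum.cong refl)
    fix i assume "i \<in> {..<s}"
    then have i: "i \<le> s" by simp
    have "real (s - i) ^ n = (- 1) ^ n * (real i - real s) ^ n"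
      using i by (simp add: of_nat_diff flip: power_mult_distrib)
    moreover have "p ^ (s - i) * q ^ i = p ^ s * y ^ i"
      using i by (simp add: q power_mult_distrib mult.assoc[symmetric] flip: power_add)
    ultimately show "real (s - i) ^ n * (p ^ (s - i) * q ^ i)
        = (- 1) ^ n * p ^ s * ((real i - real s) ^ n * y ^ i)" by simp
  qed
  finally have lhs: "(\<Sum>k=0..s. real k ^ n * (p ^ k * q ^ (s - k))) = (- 1) ^ n * p ^ s * T"
    by (simp add: T_def sum_distrib_left)
  have "poly ([:1, - 1:] ^ (n + 1) * (\<Sum>i<s. monom ((real i - real s) ^ n) i)) y
      = poly (ext_eulerian_poly n (s + 1) - monom 1 s * ext_eulerian_poly n 1) y"
    by (simp only: finite_power_sum_eq_ext_eulerian)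
  then have T: "(1 - y) ^ (n + 1) * T = P (s + 1) - y ^ s * P 1"
    unfolding poly_mult poly_power poly_diff
    by (simp add: poly_sum poly_monom poly_ext_eulerian_poly T_def P_def)
  have "(\<Sum>k=0..n. of_int (ext_eulerian n k (s + 1)) * p ^ (n - k + s) * q ^ k
                - of_int (ext_eulerian n k 1) * p ^ (n - k) * q ^ (k + s))
      = (\<Sum>k=0..n. p ^ (n + s) * (of_int (ext_eulerian n k (s + 1)) * y ^ k
                - y ^ s * (of_int (ext_eulerian n k 1) * y ^ k)))"
  proof (intro sum.cong refl)
    fix k assume "k \<in> {0..n}"
    then have "p ^ n = p ^ (n - k) * p ^ k" by (simp flip: power_add)
    then show "of_int (ext_eulerian n k (s + 1)) * p ^ (n - k + s) * q ^ k
                - of_int (ext_eulerian n k 1) * p ^ (n - k) * q ^ (k + s)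
        = p ^ (n + s) * (of_int (ext_eulerian n k (s + 1)) * y ^ k
                - y ^ s * (of_int (ext_eulerian n k 1) * y ^ k))"
      by (simp add: q power_mult_distrib power_add algebra_simps)
  qed
  also have "\<dots> = p ^ (n + s) * (P (s + 1) - y ^ s * P 1)"
    by (simp add: P_def sum_subtractf flip: sum_distrib_left)
  also have "\<dots> = p ^ (n + s) * ((1 - y) ^ (n + 1) * T)"
    by (simp only: T)
  finally have rhs: "(\<Sum>k=0..n. of_int (ext_eulerian n k (s + 1)) * p ^ (n - k + s) * q ^ k
                - of_int (ext_eulerian n k 1) * p ^ (n - k) * q ^ (k + s))
      = p ^ (n + s) * ((1 - y) ^ (n + 1) * T)" .
  \<comment> \<open>Counting powers: \<open>p * p ^ (n + s)\<close> divided by the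
    \<open>p ^ (n + 1)\<close> from this denominator is \<open>p ^ s\<close>, and the powers of
    \<open>1 - y\<close> cancel.\<close>
  have "p - q = p * (1 - y)"
    by (simp add: q algebra_simps)
  moreover have "(1 - y) ^ (n + 1) \<noteq> 0"
    using y by simp
  ultimately show ?thesis
    unfolding lhs rhs using assms(1)
    by (simp only: power_mult_distrib power_add power_one_right) simp
qed

section \<open>Faulhaber's formula\<close>

text \<open>The signs (-1)^k replace t/(e^t - 1) by t/(1 - e^(-t)). Multiplied by e^(st) - 1 this is
  t times the sum of e^(kt) for k from 1 to \<open>s\<close>; the coefficients of t^(r+1) are
  compared.\<close>

lemma power_sum_bernoulli:
  "(\<Sum>k=1..s. real k ^ r) =
     1 / (real r + 1) *
     (\<Sum>k=0..r. (- 1) ^ k * real ((r + 1) choose k) * bernoulli_number k * real s ^ (r - k + 1))"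
proof -
  define B where "B = Abs_fps (\<lambda>k. (- 1) ^ k * (bernoulli_number k / fact k))"
  \<comment> \<open>Substituting -t for t in \<open>bernoulli_number_egf\<close> produces exactly
    the signs in \<open>B\<close>.\<close>
  have "B * (fps_exp (- 1) - 1)
      = (Abs_fps (\<lambda>k. bernoulli_number k / fact k) oo (- fps_X)) * ((fps_exp 1 - 1) oo (- fps_X))"
    unfolding fps_compose_sub_distrib fps_fps_exp_compose_minus fps_compose_1
    by (simp add: B_def fps_compose_uminus')
  also have "\<dots> = (Abs_fps (\<lambda>k. bernoulli_number k / fact k) * (fps_exp 1 - 1)) oo (- fps_X)"
    by (simp add: fps_compose_mult_distrib)
  also have "\<dots> = - fps_X"
    unfolding bernoulli_number_egf by simp
  finally have "B * (fps_exp (- 1) - 1) = - fps_X" .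
  then have B: "B * (1 - fps_exp (- 1)) = fps_X"
    by (simp add: algebra_simps)
  have geometric: "(1 - fps_exp (- 1)) * (\<Sum>k=1..s. fps_exp (real k)) = fps_exp (real s) - 1"
  proof (induction s)
    case (Suc s)
    have "fps_exp (- 1) * fps_exp (1 + real s) = fps_exp (real s)"
      by (simp flip: fps_exp_add_mult)
    with Suc show ?case
      by (simp add: algebra_simps)
  qed simp
  have "B * (fps_exp (real s) - 1) = fps_X * (\<Sum>k=1..s. fps_exp (real k))"
    unfolding geometric[symmetric] mult.assoc[symmetric] B ..
  then have "fps_nth (B * (fps_exp (real s) - 1)) (Suc r)
      = fps_nth (fps_X * (\<Sum>k=1..s. fps_exp (real k))) (Suc r)"
    by (rule arg_cong)
  also have "\<dots> = (\<Sum>k=1..s. real k ^ r) / fact r"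
    by (simp add: fps_sum_nth sum_divide_distrib)
  \<comment> \<open>The convolution stops at \<open>r\<close>: the index \<open>Suc r\<close> meets
    the constant coefficient of \<open>fps_exp (real s) - 1\<close>, which is 0.\<close>
  finally have "(\<Sum>k=1..s. real k ^ r) / fact r
      = (\<Sum>k=0..r. (- 1) ^ k * (bernoulli_number k / fact k)
           * (real s ^ (Suc r - k) / fact (Suc r - k)))"
    by (simp add: fps_mult_nth B_def) (simp add: mult.commute)
  also have "\<dots> = (\<Sum>k=0..r. ((- 1) ^ k * real ((r + 1) choose k) * bernoulli_number k
                                * real s ^ (r - k + 1)) / fact (Suc r))"
    by (intro sum.cong) (auto simp: binomial_fact Suc_diff_le simp del: fact_Suc)
  finally have "(\<Sum>k=1..s. real k ^ r) = fact r * (\<Sum>k=0..r. (- 1) ^ k * real ((r + 1) choose k)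
      * bernoulli_number k * real s ^ (r - k + 1)) / fact (Suc r)"
    by (simp add: field_simps flip: sum_divide_distrib)
  also have "fact (Suc r) = fact r * (real r + 1)"
    by (simp add: algebra_simps)
  finally show ?thesis
    by simp
qed

section \<open>Moments of the s-Bernoulli law\<close>

lemma expectation_s_bernoulli:
  fixes f :: "nat \<Rightarrow> real"
  assumes "0 < p" "0 < q" "(\<Sum>k=0..s. p ^ k * q ^ (s - k)) = 1"
    and "X \<in> measurable M (count_space UNIV)"
    and "distr M (count_space UNIV) X = measure_pmf (s_bernoulli_pmf s p q)"
  shows "(\<integral>\<omega>. f (X \<omega>) \<partial>M) = (\<Sum>k=0..s. f k * (p ^ k * q ^ (s - k)))"
proof -
  note pmf = pmf_s_bernoulli[OF assms(1-3)]
  have "(\<integral>\<omega>. f (X \<omega>) \<partial>M) = (\<integral>k. f k \<partial>distr M (count_space UNIV) X)"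
    using assms(4) by (simp add: integral_distr)
  also have "\<dots> = (\<Sum>k=0..s. f k * pmf (s_bernoulli_pmf s p q) k)"
    unfolding assms(5)
    by (intro integral_measure_pmf_real) (auto simp: set_pmf_iff pmf split: if_splits)
  also have "\<dots> = (\<Sum>k=0..s. f k * (p ^ k * q ^ (s - k)))"
    by (simp add: pmf)
  finally show ?thesis .
qed

theorem theorem3p2:
  fixes M :: "'a measure" and X :: "'a \<Rightarrow> nat" and s r :: nat and p q :: real
  assumes "s \<ge> 1" and "r \<ge> 1"
    and "0 < p" and "p < 1" and "0 < q" and "q < 1"
    and "(\<Sum>k=0..s. p ^ k * q ^ (s - k)) = 1"
    and "prob_space M"
    and "X \<in> measurable M (count_space UNIV)"
    and "distr M (count_space UNIV) X = measure_pmf (s_bernoulli_pmf s p q)"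
  shows "(p \<noteq> q \<longrightarrow>
            prob_space.expectation M (\<lambda>\<omega>. real (X \<omega>) ^ r) =
              (- 1) ^ r / (p - q) ^ (r + 1) * p *
              (\<Sum>k=0..r. of_int (ext_eulerian r k (s + 1)) * p ^ (r - k + s) * q ^ k
                        - of_int (ext_eulerian r k 1) * p ^ (r - k) * q ^ (k + s))) \<and>
         (p = q \<longrightarrow>
            prob_space.expectation M (\<lambda>\<omega>. real (X \<omega>) ^ r) =
              1 / ((real r + 1) * (real s + 1)) *
              (\<Sum>k=0..r. (- 1) ^ k * real ((r + 1) choose k) * bernoulli_number k
                        * real s ^ (r - k + 1)))"
proof (intro conjI impI)
  have moment: "prob_space.expectation M (\<lambda>\<omega>. real (X \<omega>) ^ r)
      = (\<Sum>k=0..s. real k ^ r * (p ^ k * q ^ (s - k)))"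
    using assms by (intro expectation_s_bernoulli)
  show "prob_space.expectation M (\<lambda>\<omega>. real (X \<omega>) ^ r) =
      (- 1) ^ r / (p - q) ^ (r + 1) * p *
      (\<Sum>k=0..r. of_int (ext_eulerian r k (s + 1)) * p ^ (r - k + s) * q ^ k
                - of_int (ext_eulerian r k 1) * p ^ (r - k) * q ^ (k + s))" if "p \<noteq> q"
    unfolding moment using assms that by (intro homogeneous_power_sum) auto
  show "prob_space.expectation M (\<lambda>\<omega>. real (X \<omega>) ^ r) =
      1 / ((real r + 1) * (real s + 1)) *
      (\<Sum>k=0..r. (- 1) ^ k * real ((r + 1) choose k) * bernoulli_number k
                * real s ^ (r - k + 1))" if "p = q"
  proof -
    \<comment> \<open>All \<open>s + 1\<close> weights coincide, so the normalisation determines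
      their common value.\<close>
    have uniform: "p ^ k * q ^ (s - k) = p ^ s" if "k \<in> {0..s}" for k
      using that \<open>p = q\<close> by (simp flip: power_add)
    then have "(real s + 1) * p ^ s = 1"
      using assms(7) by (simp add: add.commute)
    then have "p ^ s = 1 / (real s + 1)"
      by (simp add: field_simps)
    then have "prob_space.expectation M (\<lambda>\<omega>. real (X \<omega>) ^ r)
        = (\<Sum>k=0..s. real k ^ r) / (real s + 1)"
      unfolding moment using uniform by (simp add: sum_divide_distrib)
    \<comment> \<open>The term \<open>k = 0\<close> vanishes because
      \<open>r \<ge> 1\<close>.\<close>
    also have "(\<Sum>k=0..s. real k ^ r) = (\<Sum>k=1..s. real k ^ r)"
      using assms(2) by (intro sum.mono_neutral_right) auto
    finally show ?thesis
      unfolding power_sum_bernoulli by simp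
  qed
qed

end
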